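(* For each $s \in (0,1]$, the set $\mathcal{D}^{(s)}_{\mathrm{div}} = \{ x \in [0,1] : \sum_{n \in \mathbb{N}} 1/(d_n(x))^{s} \text{ diverges} \}$ has Lebesgue measure zero.
   Context: Pierce digits. For $x \in [0,1]$, define $d_1(x) := \lfloor 1/x \rfloor$ and $T(x) := 1 - d_1(x)\,x$ if $x \neq 0$, and $d_1(0) := \infty$, $T(0) := 0$. Here $\lfloor y \rfloor$ is the largest integer not exceeding $y$. For $n \in \mathbb{N} = \{1,2,3,\dots\}$ put $d_n(x) := d_1(T^{n-1}(x))$, where $T^{n-1}$ is the $(n-1)$-fold iterate of $T$ ($T^0$ is the identity). The sequence $(d_n(x))_{n \in \mathbb{N}}$ is the Pierce expansion digit sequence of $x$. Conventions: $\infty^s := \infty$ for $s>0$ and $c/\infty := 0$ for $c \in \mathbb{R}$. *)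

theory Defs
  imports "HOL-Analysis.Analysis" "HOL-Library.Extended_Nat"
begin

(* The Pierce maps are meant for arguments in [0,1], where the floor of 1/x is nonnegative,
   so that the truncation by nat is harmless. *)

definition pierce_d1 :: "real \<Rightarrow> enat" where
  "pierce_d1 x = (if x = 0 then \<infinity> else enat (nat \<lfloor>1 / x\<rfloor>))"

definition pierce_T :: "real \<Rightarrow> real" where
  "pierce_T x = (if x = 0 then 0 else 1 - real (the_enat (pierce_d1 x)) * x)"

(* Digits are indexed from n = 1; the value at n = 0 is a dummy. *)
definition pierce_digit :: "nat \<Rightarrow> real \<Rightarrow> enat" where
  "pierce_digit n x = pierce_d1 ((pierce_T ^^ (n - 1)) x)"

(* Powers of digits with exponent s > 0, with the convention that infinity to the s is infinity. *)
definition digit_powr :: "enat \<Rightarrow> real \<Rightarrow> ereal" where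
  "digit_powr d s = (case d of enat k \<Rightarrow> ereal (real k powr s) | \<infinity> \<Rightarrow> \<infinity>)"

(* The quotient is taken in ereal, where 1 / infinity = 0. Digits of points of [0,1] are at
   least 1, so every term is a real number and real_of_ereal loses nothing. The shift by Suc
   makes the series run over n = 1, 2, 3, ... *)
definition pierce_div_set :: "real \<Rightarrow> real set" where
  "pierce_div_set s =
     {x \<in> {0..1}. \<not> summable (\<lambda>n. real_of_ereal (1 / digit_powr (pierce_digit (Suc n) x) s))}"

end

theory Submission
  imports Defs
begin

text \<open>
  Write \<open>y\<^sub>n = T\<^sup>n x\<close>. A digit \<open>d = d\<^sub>1 y\<close> satisfies \<open>1 / (d + 1) < y\<close>, hence \<open>1 / d \<le> 2 y\<close>,
  so the digit series is dominated by a multiple of the series of \<open>y\<^sub>n\<^sup>s\<close>. It is therefore enough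
  that the latter series has a finite integral over the unit interval.

  This holds because the integral of \<open>y\<^sub>n\<^sup>s\<close> is at most \<open>(1 + s)\<^sup>-\<^sup>n\<close>. Conditionally on the
  first digit being \<open>k\<close>, the point \<open>T x\<close> is uniformly distributed on \<open>[0, 1 / (k + 1))\<close>, since \<open>T\<close>
  is affine on the cell of \<open>k\<close>; so the conditional mean of \<open>(T x)\<^sup>s\<close> is \<open>(k + 1)\<^sup>-\<^sup>s / (1 + s)\<close>.
  But every \<open>x\<close> in the cell exceeds \<open>1 / (k + 1)\<close>, so the mean of \<open>x\<^sup>s\<close> there is at least
  \<open>(k + 1)\<^sup>-\<^sup>s\<close>: one step of \<open>T\<close> contracts the mean by the factor \<open>1 / (1 + s) < 1\<close>. The
  image of a cell is, up to endpoints, again an interval \<open>(0, 1 / m]\<close>, and such intervals are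
  disjoint unions of cells, so the estimate for all intervals \<open>(0, 1 / m]\<close> iterates
  (\<open>orbit_integral_decay\<close>).
\<close>

section \<open>The cells of the first digit\<close>

definition pierce_cell :: "nat \<Rightarrow> real set" where
  "pierce_cell k = {1 / (real k + 1)<..1 / real k}"

lemma pierce_T_eq: "pierce_T x = (if x = 0 then 0 else 1 - real (nat \<lfloor>1 / x\<rfloor>) * x)"
  by (simp add: pierce_T_def pierce_d1_def)

lemma pierce_T_measurable [measurable]: "pierce_T \<in> borel_measurable borel"
  unfolding pierce_T_eq[abs_def] by measurable

lemma pierce_T_funpow_measurable [measurable]: "pierce_T ^^ n \<in> borel_measurable borel"
  by (induction n) (auto intro: measurable_compose_rev[OF pierce_T_measurable] simp: o_def)

lemma pierce_T_funpow_zero: "(pierce_T ^^ n) 0 = 0"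
  by (induction n) (simp_all add: pierce_T_eq)

lemma floor_inverse_on_cell:
  assumes "k > 0" "x \<in> pierce_cell k"
  shows "nat \<lfloor>1 / x\<rfloor> = k"
proof -
  have x: "1 / (real k + 1) < x" "x \<le> 1 / real k"
    using assms by (auto simp: pierce_cell_def)
  have "x > 0"
    by (rule less_trans[OF _ x(1)]) simp
  then have "real k \<le> 1 / x" "1 / x < real k + 1"
    using x assms(1) by (auto simp: field_simps)
  then have "\<lfloor>1 / x\<rfloor> = int k"
    by (intro floor_unique) auto
  then show ?thesis by simp
qed

lemma pierce_cell_pos: "x \<in> pierce_cell k \<Longrightarrow> x > 0"
  unfolding pierce_cell_def by (auto intro: less_trans[rotated])

lemma unit_interval_mem_cell:
  assumes "x \<in> {0<..1}"
  shows "x \<in> pierce_cell (nat \<lfloor>1 / x\<rfloor>)" "nat \<lfloor>1 / x\<rfloor> > 0"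
proof -
  define k where "k = nat \<lfloor>1 / x\<rfloor>"
  have "1 / x \<ge> 1" using assms by (simp add: field_simps)
  then have "\<lfloor>1 / x\<rfloor> \<ge> 1" by simp
  then have k: "real k = real_of_int \<lfloor>1 / x\<rfloor>" "k > 0"
    unfolding k_def by linarith+
  have "real k \<le> 1 / x" "1 / x < real k + 1" unfolding k(1) by linarith+
  then show "x \<in> pierce_cell (nat \<lfloor>1 / x\<rfloor>)" "nat \<lfloor>1 / x\<rfloor> > 0"
    using assms k(2) unfolding k_def[symmetric] pierce_cell_def by (auto simp: field_simps)
qed

lemma pierce_T_on_cell:
  assumes "k > 0" "x \<in> pierce_cell k"
  shows "pierce_T x = 1 - real k * x"
  using floor_inverse_on_cell[OF assms] pierce_cell_pos[OF assms(2)] by (simp add: pierce_T_eq)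

lemma pierce_T_unit_interval:
  assumes "x \<in> {0..1}"
  shows "pierce_T x \<in> {0..1}"
proof (cases "x = 0")
  case False
  define k where "k = nat \<lfloor>1 / x\<rfloor>"
  have cell: "x \<in> pierce_cell k" and "k > 0"
    using unit_interval_mem_cell[of x] assms False by (auto simp: k_def)
  then have "0 \<le> real k * x" "real k * x \<le> 1"
    using cell assms by (auto simp: pierce_cell_def field_simps)
  then show ?thesis
    using pierce_T_on_cell[OF \<open>k > 0\<close> cell] by simp
qed (simp add: pierce_T_eq)

lemma pierce_T_funpow_unit_interval:
  "x \<in> {0..1} \<Longrightarrow> (pierce_T ^^ n) x \<in> {0..1}"
proof (induction n)
  case (Suc n)
  then show ?case using pierce_T_unit_interval[of "(pierce_T ^^ n) x"] by simp
qed simp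

text \<open>
  A positive point is at most \<open>1 / m\<close> exactly when its first digit is at least \<open>m\<close>. This is what
  makes the intervals \<open>(0, 1 / m]\<close> a family closed under splitting into cells and applying the map.
\<close>

lemma cell_decomposition:
  assumes "m > 0"
  shows "{0<..1 / real m} = (\<Union>j. pierce_cell (m + j))"
proof (intro equalityI subsetI)
  fix x assume x: "x \<in> {0<..1 / real m}"
  define k where "k = nat \<lfloor>1 / x\<rfloor>"
  have "1 / real m \<le> 1" using assms by simp
  then have "x \<in> pierce_cell k"
    using unit_interval_mem_cell(1)[of x] x by (auto simp: k_def)
  moreover have "real m \<le> 1 / x"
    using x assms by (simp add: field_simps)
  then have "m \<le> k"
    unfolding k_def by (simp add: le_nat_floor)
  ultimately show "x \<in> (\<Union>j. pierce_cell (m + j))"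
    by (auto intro!: exI[of _ "k - m"])
next
  fix x assume "x \<in> (\<Union>j. pierce_cell (m + j))"
  then obtain j where j: "x \<in> pierce_cell (m + j)" by auto
  have "x \<le> 1 / real (m + j)" using j by (simp add: pierce_cell_def)
  also have "\<dots> \<le> 1 / real m" using assms by (intro divide_left_mono) auto
  finally show "x \<in> {0<..1 / real m}" using pierce_cell_pos[OF j] by simp
qed

lemma disjoint_cells:
  assumes "m > 0"
  shows "disjoint_family (\<lambda>j. pierce_cell (m + j))"
proof -
  have "m + i = m + j" if "x \<in> pierce_cell (m + i)" "x \<in> pierce_cell (m + j)" for i j x
    using floor_inverse_on_cell[of "m + i" x] floor_inverse_on_cell[of "m + j" x] that assms
    by simp
  then show ?thesis by (fastforce simp: disjoint_family_on_def)
qed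

section \<open>Integrals over cells\<close>

lemma pierce_cell_measurable [measurable]: "pierce_cell k \<in> sets borel"
  by (simp add: pierce_cell_def)

lemma nn_integral_cells:
  fixes f :: "real \<Rightarrow> ennreal"
  assumes [measurable]: "f \<in> borel_measurable borel" and m: "m > 0"
  shows "(\<integral>\<^sup>+x\<in>{0<..1 / real m}. f x \<partial>lborel) = (\<Sum>j. \<integral>\<^sup>+x\<in>pierce_cell (m + j). f x \<partial>lborel)"
  unfolding cell_decomposition[OF m]
  by (rule nn_integral_disjoint_family) (use disjoint_cells[OF m] in auto)

text \<open>
  The change of variables \<open>y = 1 - k x\<close>, under which the cell of \<open>k\<close> corresponds to the half-open
  interval from \<open>0\<close> to \<open>1 - k / (k + 1) = 1 / (k + 1)\<close>.
\<close>

lemma nn_integral_branch: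
  fixes g :: "real \<Rightarrow> ennreal"
  assumes [measurable]: "g \<in> borel_measurable borel" and k: "k > 0"
  shows "(\<integral>\<^sup>+x\<in>pierce_cell k. g (pierce_T x) \<partial>lborel)
           = ennreal (1 / real k) * (\<integral>\<^sup>+y\<in>{0..<1 / (real k + 1)}. g y \<partial>lborel)"
proof -
  have "(\<integral>\<^sup>+x\<in>pierce_cell k. g (pierce_T x) \<partial>lborel)
      = (\<integral>\<^sup>+x. g (1 - real k * x) * indicator (pierce_cell k) x \<partial>lborel)"
    by (intro nn_integral_cong) (auto simp: indicator_def pierce_T_on_cell[OF k])
  also have "\<dots> = ennreal \<bar>- 1 / real k\<bar> *
      (\<integral>\<^sup>+y. g (1 - real k * (1 / real k + (- 1 / real k) * y))
        * indicator (pierce_cell k) (1 / real k + (- 1 / real k) * y) \<partial>lborel)"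
    by (rule nn_integral_real_affine) (use k in auto)
  also have "(\<integral>\<^sup>+y. g (1 - real k * (1 / real k + (- 1 / real k) * y))
        * indicator (pierce_cell k) (1 / real k + (- 1 / real k) * y) \<partial>lborel)
      = (\<integral>\<^sup>+y\<in>{0..<1 / (real k + 1)}. g y \<partial>lborel)"
  proof (intro nn_integral_cong)
    fix y :: real
    have "1 / real k + (- 1 / real k) * y \<in> pierce_cell k \<longleftrightarrow> y \<in> {0..<1 / (real k + 1)}"
      using k by (auto simp: pierce_cell_def field_simps zero_le_mult_iff)
    moreover have "1 - real k * (1 / real k + (- 1 / real k) * y) = y"
      using k by (simp add: field_simps)
    ultimately show "g (1 - real k * (1 / real k + (- 1 / real k) * y))
        * indicator (pierce_cell k) (1 / real k + (- 1 / real k) * y)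
        = g y * indicator {0..<1 / (real k + 1)} y"
      by (simp add: indicator_def)
  qed
  finally show ?thesis by simp
qed

lemma nn_integral_powr:
  assumes "s > 0" "a > 0"
  shows "(\<integral>\<^sup>+x\<in>{0<..a}. ennreal (x powr s) \<partial>lborel) = ennreal (a powr (s + 1) / (s + 1))"
proof -
  have "((\<lambda>x. x powr s) has_integral a powr (s + 1) / (s + 1)) {0..a}"
    using assms by (intro has_integral_powr_from_0) auto
  then have "(\<integral>\<^sup>+x\<in>{0..a}. ennreal (x powr s) \<partial>lborel) = ennreal (a powr (s + 1) / (s + 1))"
    by (intro nn_integral_has_integral_lebesgue') auto
  also have "(\<integral>\<^sup>+x\<in>{0..a}. ennreal (x powr s) \<partial>lborel)
      = (\<integral>\<^sup>+x\<in>{0<..a}. ennreal (x powr s) \<partial>lborel)"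
    by (intro nn_integral_cong) (auto simp: indicator_def)
  finally show ?thesis .
qed

text \<open>
  The cell has length \<open>1 / (k (k + 1))\<close>, and \<open>x\<^sup>s\<close> is at least its value at the left endpoint. The
  bound is written so that it is \<open>s + 1\<close> times the integral of \<open>(T x)\<^sup>s\<close> over the cell, which is
  the origin of the contraction factor.
\<close>

lemma cell_powr_lower:
  assumes "s > 0" "k > 0"
  shows "ennreal (1 / real k * (1 / (real k + 1)) powr (s + 1))
           \<le> (\<integral>\<^sup>+x\<in>pierce_cell k. ennreal (x powr s) \<partial>lborel)"
proof -
  define a where "a = 1 / (real k + 1)"
  have a: "a > 0" "1 / real k - a = 1 / real k * a"
    using assms by (auto simp: a_def field_simps)
  then have le: "a \<le> 1 / real k"
    by (smt (verit) divide_nonneg_nonneg mult_nonneg_nonneg of_nat_0_le_iff)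
  have "ennreal (1 / real k * a powr (s + 1)) = ennreal (a powr s) * ennreal (1 / real k - a)"
    unfolding a(2) using a(1) by (simp add: powr_add ennreal_mult' mult_ac flip: ennreal_mult)
  also have "\<dots> = (\<integral>\<^sup>+x\<in>pierce_cell k. ennreal (a powr s) \<partial>lborel)"
    using le by (simp add: nn_integral_cmult_indicator pierce_cell_def a_def)
  also have "\<dots> \<le> (\<integral>\<^sup>+x\<in>pierce_cell k. ennreal (x powr s) \<partial>lborel)"
    using a(1) assms(1)
    by (intro nn_integral_mono) (auto simp: indicator_def pierce_cell_def a_def intro!: ennreal_leI powr_mono2)
  finally show ?thesis by (simp add: a_def)
qed

section \<open>Decay along orbits\<close>

text \<open>
  The induction removes the first step of the orbit rather than the last: the branch of digit \<open>k\<close>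
  then turns the claim at \<open>Suc n\<close> into the claim at \<open>n\<close> for the interval \<open>(0, 1 / (k + 1)]\<close>, for
  which reason \<open>m\<close> must be arbitrary. The right-hand side keeps the integral of \<open>x\<^sup>s\<close> unevaluated,
  so that the estimates on the cells add up to the estimate on their union.
\<close>

lemma orbit_integral_decay:
  assumes s: "s > 0" and m: "m > 0"
  shows "(\<integral>\<^sup>+x\<in>{0<..1 / real m}. ennreal (((pierce_T ^^ n) x) powr s) \<partial>lborel)
           \<le> ennreal ((1 / (s + 1)) ^ n) * (\<integral>\<^sup>+x\<in>{0<..1 / real m}. ennreal (x powr s) \<partial>lborel)"
  using m
proof (induction n arbitrary: m)
  case (Suc n)
  let ?c = "1 / (s + 1)"
  have branch: "(\<integral>\<^sup>+x\<in>pierce_cell k. ennreal (((pierce_T ^^ Suc n) x) powr s) \<partial>lborel)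
      \<le> ennreal (?c ^ Suc n) * (\<integral>\<^sup>+x\<in>pierce_cell k. ennreal (x powr s) \<partial>lborel)"
    if k: "k > 0" for k
  proof -
    let ?b = "1 / (real k + 1)"
    have "(\<integral>\<^sup>+x\<in>pierce_cell k. ennreal (((pierce_T ^^ Suc n) x) powr s) \<partial>lborel)
        = ennreal (1 / real k) * (\<integral>\<^sup>+y\<in>{0..<?b}. ennreal (((pierce_T ^^ n) y) powr s) \<partial>lborel)"
      using nn_integral_branch[OF _ k, of "\<lambda>y. ennreal (((pierce_T ^^ n) y) powr s)"]
      by (simp del: funpow.simps add: funpow_Suc_right o_def)
    also have "\<dots> \<le> ennreal (1 / real k) * (\<integral>\<^sup>+y\<in>{0<..1 / real (Suc k)}. ennreal (((pierce_T ^^ n) y) powr s) \<partial>lborel)"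
    \<comment> \<open>The image interval contains \<open>0\<close>, unlike the intervals of the induction hypothesis, but the
       integrand vanishes there because \<open>0\<close> is a fixed point.\<close>
    proof (rule mult_left_mono, rule nn_integral_mono)
      fix y
      show "ennreal (((pierce_T ^^ n) y) powr s) * indicator {0..<?b} y
          \<le> ennreal (((pierce_T ^^ n) y) powr s) * indicator {0<..1 / real (Suc k)} y"
        by (cases "y = 0") (auto simp: indicator_def pierce_T_funpow_zero add.commute)
    qed simp
    also have "\<dots> \<le> ennreal (1 / real k) * (ennreal (?c ^ n) * ennreal (?b powr (s + 1) / (s + 1)))"
      using Suc.IH[of "Suc k"] nn_integral_powr[OF s, of ?b]
      by (intro mult_left_mono) (auto simp: add.commute)
    also have "\<dots> = ennreal (?c ^ Suc n) * ennreal (1 / real k * ?b powr (s + 1))"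
      using s by (simp add: field_simps flip: ennreal_mult)
    also have "\<dots> \<le> ennreal (?c ^ Suc n) * (\<integral>\<^sup>+x\<in>pierce_cell k. ennreal (x powr s) \<partial>lborel)"
      by (intro mult_left_mono cell_powr_lower s k) simp
    finally show ?thesis .
  qed
  have "(\<integral>\<^sup>+x\<in>{0<..1 / real m}. ennreal (((pierce_T ^^ Suc n) x) powr s) \<partial>lborel)
      = (\<Sum>j. \<integral>\<^sup>+x\<in>pierce_cell (m + j). ennreal (((pierce_T ^^ Suc n) x) powr s) \<partial>lborel)"
    by (rule nn_integral_cells[OF _ Suc.prems]) measurable
  also have "\<dots> \<le> (\<Sum>j. ennreal (?c ^ Suc n) * (\<integral>\<^sup>+x\<in>pierce_cell (m + j). ennreal (x powr s) \<partial>lborel))"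
    using Suc.prems by (intro suminf_le branch) auto
  also have "\<dots> = ennreal (?c ^ Suc n) * (\<integral>\<^sup>+x\<in>{0<..1 / real m}. ennreal (x powr s) \<partial>lborel)"
    by (simp add: ennreal_suminf_cmult nn_integral_cells[OF _ Suc.prems])
  finally show ?case .
qed simp

lemma AE_summable_orbit:
  assumes s: "s > 0"
  shows "AE x in lborel. x \<in> {0<..1} \<longrightarrow> summable (\<lambda>n. ((pierce_T ^^ n) x) powr s)"
proof -
  let ?f = "\<lambda>n x. ennreal (((pierce_T ^^ n) x) powr s) * indicator {0<..1} x"
  let ?c = "1 / (s + 1)"
  have "(\<integral>\<^sup>+x. (\<Sum>n. ?f n x) \<partial>lborel) = (\<Sum>n. \<integral>\<^sup>+x. ?f n x \<partial>lborel)"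
    by (rule nn_integral_suminf) measurable
  also have "\<dots> \<le> (\<Sum>n. ennreal (?c ^ Suc n))"
  proof (intro suminf_le)
    fix n
    show "(\<integral>\<^sup>+x. ?f n x \<partial>lborel) \<le> ennreal (?c ^ Suc n)"
      using orbit_integral_decay[OF s, of 1 n] nn_integral_powr[OF s, of 1] s
      by (simp add: field_simps flip: ennreal_mult)
  qed auto
  also have "\<dots> = ennreal (\<Sum>n. ?c ^ Suc n)"
    using s by (intro suminf_ennreal2 summable_Suc_iff[THEN iffD2] summable_geometric) (auto simp: field_simps)
  also have "\<dots> < \<infinity>" by simp
  finally have "AE x in lborel. (\<Sum>n. ?f n x) \<noteq> \<infinity>"
    by (intro nn_integral_PInf_AE) auto
  then show ?thesis
  proof eventually_elim
    case (elim x)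
    show ?case
    proof
      assume "x \<in> {0<..1}"
      with elim have "(\<Sum>n. ennreal (((pierce_T ^^ n) x) powr s)) \<noteq> top" by simp
      then show "summable (\<lambda>n. ((pierce_T ^^ n) x) powr s)"
        by (intro summable_suminf_not_top) auto
    qed
  qed
qed

section \<open>Comparison with the digit series\<close>

text \<open>
  At \<open>x = 0\<close> the digit is \<open>\<infinity>\<close> and both sides vanish, the left one by the convention for
  reciprocals. Otherwise the digit \<open>k\<close> is at least \<open>1\<close>, so \<open>1 / k \<le> 2 / (k + 1) < 2 x\<close>.
\<close>

lemma pierce_term_le:
  assumes s: "s > 0" and x: "x \<in> {0..1}"
  defines "t \<equiv> real_of_ereal (1 / digit_powr (pierce_d1 x) s)"
  shows "0 \<le> t" "t \<le> 2 powr s * x powr s"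
proof -
  have "0 \<le> t \<and> t \<le> 2 powr s * x powr s"
  proof (cases "x = 0")
    case True
    then show ?thesis by (simp add: t_def pierce_d1_def digit_powr_def)
  next
    case False
    define k where "k = nat \<lfloor>1 / x\<rfloor>"
    have cell: "x \<in> pierce_cell k" and k: "k > 0"
      using unit_interval_mem_cell[of x] x False by (auto simp: k_def)
    have t: "t = 1 / real k powr s"
      using False k by (simp add: t_def pierce_d1_def digit_powr_def k_def[symmetric] one_ereal_def ereal_divide)
    also have "\<dots> = (1 / real k) powr s"
      by (simp add: powr_divide)
    also have "1 / real k \<le> 2 * (1 / (real k + 1))"
      using k by (simp add: field_simps)
    then have "1 / real k \<le> 2 * x"
      using cell by (simp add: pierce_cell_def)
    then have "(1 / real k) powr s \<le> (2 * x) powr s"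
      using s by (intro powr_mono2) auto
    also have "\<dots> = 2 powr s * x powr s"
      using x by (simp add: powr_mult)
    finally show ?thesis using t by simp
  qed
  then show "0 \<le> t" "t \<le> 2 powr s * x powr s" by auto
qed

lemma summable_pierce_terms:
  assumes s: "s > 0" and x: "x \<in> {0..1}"
    and sum: "summable (\<lambda>n. ((pierce_T ^^ n) x) powr s)"
  shows "summable (\<lambda>n. real_of_ereal (1 / digit_powr (pierce_digit (Suc n) x) s))"
proof (rule summable_comparison_test'[where N = 0])
  show "summable (\<lambda>n. 2 powr s * ((pierce_T ^^ n) x) powr s)"
    using sum by (rule summable_mult)
  show "norm (real_of_ereal (1 / digit_powr (pierce_digit (Suc n) x) s))
      \<le> 2 powr s * ((pierce_T ^^ n) x) powr s" for n
    using pierce_term_le[OF s pierce_T_funpow_unit_interval[OF x, of n]]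
    unfolding pierce_digit_def real_norm_def diff_Suc_1 by linarith
qed

theorem theorem1p11:
  fixes s :: real
  assumes "s \<in> {0<..1}"
  shows "pierce_div_set s \<in> null_sets lebesgue"
proof -
  have s: "s > 0" using assms by simp
  have "AE x in lborel. x \<notin> pierce_div_set s"
    using AE_summable_orbit[OF s]
  proof eventually_elim
    case (elim x)
    have "summable (\<lambda>n. ((pierce_T ^^ n) x) powr s)" if "x \<in> {0..1}"
      using elim that by (cases "x = 0") (auto simp: pierce_T_funpow_zero)
    then show ?case
      using summable_pierce_terms[OF s] by (auto simp: pierce_div_set_def)
  qed
  then obtain N where "N \<in> null_sets lborel" "pierce_div_set s \<subseteq> N"
    by (auto simp: eventually_ae_filter)
  then show ?thesis
    by (meson null_sets_completionI null_sets_completion_subset)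
qed

end
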